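(* For $x,y\in\mathcal{BT}$ set $\langle x,y\rangle=\Phi(x)(y)$. Then: 1. $\langle 1,x\rangle=\varepsilon(x)$ for all $x\in\mathcal{BT}$. 2. $\langle xy,z\rangle=\sum_z\langle x,z^{(1)}\rangle\langle y,z^{(2)}\rangle$ for all $x,y,z\in\mathcal{BT}$. 3. $\langle B(x\otimes y),z\rangle=\sum_z\langle x,z_{(1)}\rangle\langle y,z_{(2)}\rangle$ for all $x,y,z\in\mathcal{BT}$. Moreover: 4. $\langle -,-\rangle$ is symmetric. 5. If $x$ and $y$ are homogeneous of different degrees, $\langle x,y\rangle=0$. 6. $\langle S(x),y\rangle=\langle x,S(y)\rangle$ for all $x,y\in\mathcal{BT}$, where $S$ is the antipode of $\mathcal{BT}$.
   Context: $\mathbb{K}$ is a commutative field of any characteristic. We consider planar rooted forests (finite ordered sequences of planar rooted trees) whose edges are decorated by $l$ or $r$; the degree $|F|$ of a forest $F$ is its number of vertices, and $1$ is the empty forest. For two such forests $F,G$, $B(F\otimes G)$ is the tree obtained by grafting the roots of the trees of $F$ followed by those of $G$ (in this left-to-right order) on a common new root, the edges from the new root to the roots of $F$ being decorated by $l$ and those to the roots of $G$ by $r$. In particular $B(1\otimes 1)=\bullet$. Let $\mathbb{T}$ be the set consisting of $1$ and of the trees obtained inductively as $B(F_1\cdots F_p\otimes G_1\cdots G_q)$, $p,q\ge 0$, with all $F_i,G_j$ nonempty trees already in $\mathbb{T}$; $\mathbb{F}$ is the set of forests all of whose trees are in $\mathbb{T}$ (including $1$). $\mathcal{BT}$ is the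 $\mathbb{K}$-vector space with basis $\mathbb{F}$, a unital associative algebra for concatenation, graded by degree; $B$ is extended linearly. $\varepsilon(F)=\delta_{F,1}$. $\mathcal{BT}$ is a graded connected Hopf algebra with counit $\varepsilon$ and coproduct $\Delta$, the unique algebra morphism such that $\Delta(B(x\otimes y))=B(x\otimes y)\otimes 1+\sum x^{(1)}y^{(1)}\otimes B(x^{(2)}\otimes y^{(2)})$, where $\Delta(x)=\sum_x x^{(1)}\otimes x^{(2)}$ (Sweedler notation). Let $\gamma:\mathbb{K}[\mathbb{T}]\to\mathcal{BT}\otimes\mathcal{BT}$ be the linear map, homogeneous of degree $-1$, with $\gamma(B(F\otimes G))=(-1)^{|G|}F\otimes G$ for all $F,G\in\mathbb{F}$ (and $\gamma(1)=0$). Let $\Gamma:\mathcal{BT}\to\mathcal{BT}\otimes\mathcal{BT}$ be the linear map with $\Gamma(1)=0$ and $\Gamma(T_1\cdots T_n)=\Delta(T_1)\cdots\Delta(T_{n-1})\gamma(T_n)$ for nonempty trees $T_1,\dots,T_n\in\mathbb{T}$, $n\ge 1$ (product in $\mathcal{BT}\otimes\mathcal{BT}$). Write $\Gamma(x)=\sum_x x_{(1)}\otimes x_{(2)}$. Let $\mathcal{BT}^{\circledast}=\bigoplus_n(\mathcal{BT}_n)^*$ be the graded dual Hopf algebra and $\Gamma^*:\mathcal{BT}^{\circledast}\otimes\mathcal{BT}^{\circledast}\to\mathcal{BT}^{\circledast}$ the transpose of $\Gamma$. $\Phi:\mathcal{BT}\to\mathcal{BT}^{\circledast}$ is the unique algebra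 morphism such that $\Phi\circ B=\Gamma^*\circ(\Phi\otimes\Phi)$ (it exists and is unique because for every unital algebra $A$ and linear map $L:A\otimes A\to A$ there is a unique algebra morphism $\phi:\mathcal{BT}\to A$ with $\phi\circ B=L\circ(\phi\otimes\phi)$). *)

theory Defs
  imports Complex_Main "HOL-Library.Poly_Mapping" "HOL-Library.Product_Plus"
begin

section \<open>Forests\<close>

text \<open>
  The datatype is the inductively generated set of nonempty trees:
  \<open>Node [F\<^sub>1,\<dots>,F\<^sub>p] [G\<^sub>1,\<dots>,G\<^sub>q]\<close> is the planar tree whose root has the subtrees
  \<open>F\<^sub>1,\<dots>,F\<^sub>p,G\<^sub>1,\<dots>,G\<^sub>q\<close> from left to right, the edges to the \<open>F\<^sub>i\<close> being decorated
  by \<open>l\<close> and those to the \<open>G\<^sub>j\<close> by \<open>r\<close>.  The empty tree and the empty forest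
  are both the empty list.
\<close>

datatype tree = Node "tree list" "tree list"

type_synonym forest = "tree list"

fun deg :: "forest \<Rightarrow> nat" where
  "deg [] = 0"
| "deg (Node F G # H) = Suc (deg F + deg G) + deg H"

instantiation list :: (type) monoid_add
begin
definition zero_list :: "'a list" where "0 = []"
definition plus_list :: "'a list \<Rightarrow> 'a list \<Rightarrow> 'a list" where "xs + ys = xs @ ys"
instance by standard (simp_all add: zero_list_def plus_list_def)
end


section \<open>The algebra and its tensor square\<close>

text \<open>
  Since concatenation is the addition of the monoid of forests, the convolution product of
  \<open>forest \<Rightarrow>\<^sub>0 'k\<close> is the bilinear extension of concatenation.  The tensor square is
  identified with the free vector space on pairs of forests; its convolution product is
  \<open>(a \<otimes> b)(c \<otimes> d) = ac \<otimes> bd\<close>.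
\<close>

type_synonym 'k bt = "forest \<Rightarrow>\<^sub>0 'k"
type_synonym 'k bt2 = "(forest \<times> forest) \<Rightarrow>\<^sub>0 'k"

definition scale :: "'k::field \<Rightarrow> ('a \<Rightarrow>\<^sub>0 'k) \<Rightarrow> ('a \<Rightarrow>\<^sub>0 'k)" where
  "scale c x = Poly_Mapping.map ((*) c) x"

abbreviation basis :: "'a \<Rightarrow> ('a \<Rightarrow>\<^sub>0 'k::field)" where
  "basis a \<equiv> Poly_Mapping.single a 1"

definition lin :: "('a \<Rightarrow> ('b \<Rightarrow>\<^sub>0 'k::field)) \<Rightarrow> ('a \<Rightarrow>\<^sub>0 'k) \<Rightarrow> ('b \<Rightarrow>\<^sub>0 'k)" where
  "lin f x = (\<Sum>a\<in>Poly_Mapping.keys x. scale (Poly_Mapping.lookup x a) (f a))"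

definition bilin ::
    "('a \<Rightarrow> 'b \<Rightarrow> ('c \<Rightarrow>\<^sub>0 'k::field)) \<Rightarrow> ('a \<Rightarrow>\<^sub>0 'k) \<Rightarrow> ('b \<Rightarrow>\<^sub>0 'k) \<Rightarrow> ('c \<Rightarrow>\<^sub>0 'k)" where
  "bilin f x y = lin (\<lambda>a. lin (f a) y) x"

definition tensor :: "'k::field bt \<Rightarrow> 'k bt \<Rightarrow> 'k bt2" where
  "tensor = bilin (\<lambda>F G. basis (F, G))"

definition graft :: "'k::field bt2 \<Rightarrow> 'k bt" where
  "graft = lin (\<lambda>(F, G). basis [Node F G])"

definition counit :: "'k::field bt \<Rightarrow> 'k" where
  "counit x = Poly_Mapping.lookup x []"

definition homogeneous :: "nat \<Rightarrow> 'k::field bt \<Rightarrow> bool" where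
  "homogeneous n x \<longleftrightarrow> (\<forall>F\<in>Poly_Mapping.keys x. deg F = n)"


section \<open>Coproduct and antipode\<close>

text \<open>
  \<open>cograft u v\<close> is the sum of the \<open>u\<^sup>1 v\<^sup>1 \<otimes> B(u\<^sup>2 \<otimes> v\<^sup>2)\<close> for
  \<open>u = \<Sum> u\<^sup>1 \<otimes> u\<^sup>2\<close> and \<open>v = \<Sum> v\<^sup>1 \<otimes> v\<^sup>2\<close>.
\<close>

definition cograft :: "'k::field bt2 \<Rightarrow> 'k bt2 \<Rightarrow> 'k bt2" where
  "cograft = bilin (\<lambda>(a, b) (c, d). basis (a + c, [Node b d]))"

definition is_coproduct :: "('k::field bt \<Rightarrow> 'k bt2) \<Rightarrow> bool" where
  "is_coproduct D \<longleftrightarrow>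
     Vector_Spaces.linear scale scale D \<and>
     D 1 = 1 \<and>
     (\<forall>x y. D (x * y) = D x * D y) \<and>
     (\<forall>x y. D (graft (tensor x y)) = tensor (graft (tensor x y)) 1 + cograft (D x) (D y))"

definition Delta :: "'k::field bt \<Rightarrow> 'k bt2" where
  "Delta = (THE D. is_coproduct D)"

definition is_antipode :: "('k::field bt \<Rightarrow> 'k bt) \<Rightarrow> bool" where
  "is_antipode S \<longleftrightarrow>
     Vector_Spaces.linear scale scale S \<and>
     (\<forall>x. lin (\<lambda>(F, G). S (basis F) * basis G) (Delta x) = scale (counit x) 1) \<and>
     (\<forall>x. lin (\<lambda>(F, G). basis F * S (basis G)) (Delta x) = scale (counit x) 1)"

definition antipode :: "'k::field bt \<Rightarrow> 'k bt" where
  "antipode = (THE S. is_antipode S)"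


section \<open>The maps \<open>\<gamma>\<close> and \<open>\<Gamma>\<close>\<close>

text \<open>
  Only the values of \<open>\<gamma>\<close> on nonempty trees enter the definition of \<open>\<Gamma>\<close>.
\<close>

fun gamma :: "tree \<Rightarrow> 'k::field bt2" where
  "gamma (Node F G) = scale ((-1) ^ deg G) (basis (F, G))"

definition Gamma :: "'k::field bt \<Rightarrow> 'k bt2" where
  "Gamma = lin (\<lambda>F. if F = [] then 0
     else prod_list (map (\<lambda>t. Delta (basis [t])) (butlast F)) * gamma (last F))"


section \<open>The graded dual and the pairing\<close>

text \<open>
  Elements of the graded dual are the linear forms vanishing on all but finitely many
  homogeneous components.  \<open>tensor_form f g\<close> is the linear form \<open>f \<otimes> g\<close> on the tensor
  square, so \<open>dual_mult\<close> is the transpose of the coproduct and \<open>Gamma_star f g\<close> is the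
  image of \<open>f \<otimes> g\<close> under the transpose of \<open>\<Gamma>\<close>.
\<close>

definition graded_dual :: "('k::field bt \<Rightarrow> 'k) set" where
  "graded_dual = {f. Vector_Spaces.linear scale (*) f \<and>
     finite {n. \<exists>x. homogeneous n x \<and> f x \<noteq> 0}}"

definition tensor_form :: "('k::field bt \<Rightarrow> 'k) \<Rightarrow> ('k bt \<Rightarrow> 'k) \<Rightarrow> 'k bt2 \<Rightarrow> 'k" where
  "tensor_form f g t = (\<Sum>(F, G)\<in>Poly_Mapping.keys t.
     Poly_Mapping.lookup t (F, G) * (f (basis F) * g (basis G)))"

definition dual_mult :: "('k::field bt \<Rightarrow> 'k) \<Rightarrow> ('k bt \<Rightarrow> 'k) \<Rightarrow> 'k bt \<Rightarrow> 'k" where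
  "dual_mult f g = (\<lambda>z. tensor_form f g (Delta z))"

definition Gamma_star :: "('k::field bt \<Rightarrow> 'k) \<Rightarrow> ('k bt \<Rightarrow> 'k) \<Rightarrow> 'k bt \<Rightarrow> 'k" where
  "Gamma_star f g = (\<lambda>z. tensor_form f g (Gamma z))"

definition is_Phi :: "('k::field bt \<Rightarrow> 'k bt \<Rightarrow> 'k) \<Rightarrow> bool" where
  "is_Phi \<phi> \<longleftrightarrow>
     (\<forall>x. \<phi> x \<in> graded_dual) \<and>
     (\<forall>z. Vector_Spaces.linear scale (*) (\<lambda>x. \<phi> x z)) \<and>
     \<phi> 1 = counit \<and>
     (\<forall>x y. \<phi> (x * y) = dual_mult (\<phi> x) (\<phi> y)) \<and>
     (\<forall>x y. \<phi> (graft (tensor x y)) = Gamma_star (\<phi> x) (\<phi> y))"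

definition Phi :: "'k::field bt \<Rightarrow> 'k bt \<Rightarrow> 'k" where
  "Phi = (THE \<phi>. is_Phi \<phi>)"

definition pairing :: "'k::field bt \<Rightarrow> 'k bt \<Rightarrow> 'k" where
  "pairing x y = Phi x y"


section \<open>The defining properties of \<open>Delta\<close>, \<open>antipode\<close> and \<open>Phi\<close>\<close>

lemma lookup_scale [simp]: "Poly_Mapping.lookup (scale c x) a = c * Poly_Mapping.lookup x a"
  by (simp add: scale_def map.rep_eq when_def)

lemma vector_space_scale: "vector_space (scale :: 'k::field \<Rightarrow> ('a \<Rightarrow>\<^sub>0 'k) \<Rightarrow> _)"
  by unfold_locales (auto intro!: poly_mapping_eqI simp: lookup_add algebra_simps)

lemma vector_space_mult: "vector_space ((*) :: 'k::field \<Rightarrow> 'k \<Rightarrow> 'k)"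
  by unfold_locales (auto simp: algebra_simps)

interpretation sc: vector_space "scale :: 'k::field \<Rightarrow> ('a \<Rightarrow>\<^sub>0 'k) \<Rightarrow> _"
  by (rule vector_space_scale)

lemma linear_scale_iff:
  "Vector_Spaces.linear scale scale f \<longleftrightarrow>
     (\<forall>x y. f (x + y) = f x + f y) \<and> (\<forall>c x. f (scale c x) = scale c (f x))"
  by (simp add: Vector_Spaces.linear_iff vector_space_scale)

lemma linear_form_iff:
  "Vector_Spaces.linear scale (*) f \<longleftrightarrow>
     (\<forall>x y. f (x + y) = f x + f y) \<and> (\<forall>c x. f (scale c x) = c * f x)"
  by (simp add: Vector_Spaces.linear_iff vector_space_scale vector_space_mult)

lemma lin_superset:
  assumes "finite A" "Poly_Mapping.keys x \<subseteq> A"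
  shows "lin f x = (\<Sum>a\<in>A. scale (Poly_Mapping.lookup x a) (f a))"
  unfolding lin_def using assms
  by (intro sum.mono_neutral_left) (auto simp: in_keys_iff)

lemma keys_scale: "Poly_Mapping.keys (scale c x) \<subseteq> Poly_Mapping.keys x"
  by (auto simp: in_keys_iff)

lemma lin_basis [simp]: "lin f (basis a) = f a"
  by (simp add: lin_def)

lemma lin_add: "lin f (x + y) = lin f x + lin f y"
proof -
  let ?A = "Poly_Mapping.keys x \<union> Poly_Mapping.keys y"
  have "Poly_Mapping.keys (x + y) \<subseteq> ?A" by (rule Poly_Mapping.keys_add)
  then show ?thesis
    by (simp add: lin_superset[where A = ?A] lookup_add sc.scale_left_distrib sum.distrib)
qed

lemma lin_scale: "lin f (scale c x) = scale c (lin f x)"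
  using keys_scale[of c x]
  by (simp add: lin_superset[where A = "Poly_Mapping.keys x"] sc.scale_sum_right)

lemma lin_zero [simp]: "lin f 0 = 0"
  by (simp add: lin_def)

lemma lin_fun_add: "lin (\<lambda>a. f a + g a) x = lin f x + lin g x"
  by (simp add: lin_def sc.scale_right_distrib sum.distrib)

lemma lin_fun_scale: "lin (\<lambda>a. scale c (f a)) x = scale c (lin f x)"
  by (simp add: lin_def sc.scale_sum_right mult.commute)

lemmas lin_simps = lin_add lin_scale lin_fun_add lin_fun_scale

lemma linear_lin: "Vector_Spaces.linear scale scale (lin f)"
  by (simp add: linear_scale_iff lin_simps)

lemma sum_basis: "(\<Sum>a\<in>Poly_Mapping.keys x. scale (Poly_Mapping.lookup x a) (basis a)) = x"
proof (rule poly_mapping_eqI)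
  fix b
  have "Poly_Mapping.lookup (\<Sum>a\<in>Poly_Mapping.keys x. scale (Poly_Mapping.lookup x a) (basis a)) b
     = (\<Sum>a\<in>Poly_Mapping.keys x. if a = b then Poly_Mapping.lookup x a else 0)"
    unfolding lookup_sum by (intro sum.cong) (simp_all add: lookup_single when_def)
  also have "\<dots> = Poly_Mapping.lookup x b"
    by (auto simp: in_keys_iff)
  finally show "Poly_Mapping.lookup (\<Sum>a\<in>Poly_Mapping.keys x. scale (Poly_Mapping.lookup x a) (basis a)) b
     = Poly_Mapping.lookup x b" .
qed

lemma bt_induct [case_names basis add scale]:
  fixes x :: "'a \<Rightarrow>\<^sub>0 'k::field"
  assumes b: "\<And>a. P (basis a)"
    and a: "\<And>x y. P x \<Longrightarrow> P y \<Longrightarrow> P (x + y)"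
    and s: "\<And>c x. P x \<Longrightarrow> P (scale c x)"
  shows "P x"
proof -
  have z: "P 0" using s[OF b, of 0] by simp
  have "P (\<Sum>a\<in>A. scale (Poly_Mapping.lookup x a) (basis a))" if "finite A" for A
    using that by (induction A) (auto intro: z a s b)
  from this[OF finite_keys, of x] show ?thesis by (simp add: sum_basis)
qed

lemma linear_basis_eq:
  assumes "Vector_Spaces.linear scale scale f" "Vector_Spaces.linear scale scale g"
    and "\<And>a. f (basis a) = g (basis a)"
  shows "f x = g x"
  using assms by (induction x rule: bt_induct) (simp_all add: linear_scale_iff)

lemma linear_form_basis_eq:
  assumes "Vector_Spaces.linear scale (*) f" "Vector_Spaces.linear scale (*) g"
    and "\<And>a. f (basis a) = g (basis a)"
  shows "f x = g x"
  using assms by (induction x rule: bt_induct) (simp_all add: linear_form_iff)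

lemma bilin_basis [simp]: "bilin f (basis a) (basis b) = f a b"
  by (simp add: bilin_def)

lemma bilin_simps:
  "bilin f (x + x') y = bilin f x y + bilin f x' y"
  "bilin f x (y + y') = bilin f x y + bilin f x y'"
  "bilin f (scale c x) y = scale c (bilin f x y)"
  "bilin f x (scale c y) = scale c (bilin f x y)"
  by (simp_all add: bilin_def lin_simps)

lemma scale_single: "scale c (Poly_Mapping.single a d) = Poly_Mapping.single a (c * d)"
  by (rule poly_mapping_eqI) (simp add: lookup_single when_def)

lemma single_induct [case_names single add]:
  fixes x :: "'a \<Rightarrow>\<^sub>0 'k::field"
  assumes b: "\<And>a c. P (Poly_Mapping.single a c)"
    and a: "\<And>x y. P x \<Longrightarrow> P y \<Longrightarrow> P (x + y)"
  shows "P x"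
proof -
  have z: "P 0" using b[of undefined 0] by simp
  have "P (\<Sum>a\<in>A. scale (Poly_Mapping.lookup x a) (basis a))" if "finite A" for A
    using that by (induction A) (auto intro: z a b simp: scale_single)
  from this[OF finite_keys, of x] show ?thesis by (simp add: sum_basis)
qed

lemma scale_mult:
  fixes x y :: "'a::monoid_add \<Rightarrow>\<^sub>0 'k::field"
  shows "scale c x * y = scale c (x * y)" "x * scale c y = scale c (x * y)"
proof -
  have *: "scale c (Poly_Mapping.single a d) * y = scale c (Poly_Mapping.single a d * y)"
    "Poly_Mapping.single a d * scale c y = scale c (Poly_Mapping.single a d * y)" for a d
    by (induction y rule: single_induct)
      (simp_all add: scale_single mult_single distrib_left sc.scale_right_distrib mult_ac)
  show "scale c x * y = scale c (x * y)" "x * scale c y = scale c (x * y)"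
    by (induction x rule: single_induct)
      (simp_all add: * distrib_right sc.scale_right_distrib)
qed

lemma basis_mult: "basis a * basis b = basis (a + b)"
  by (simp add: mult_single)

lemma basis_Nil: "basis [] = 1"
  by (simp add: zero_list_def flip: single_one)

lemma basis_Nil2: "basis ([], []) = 1"
  by (simp add: zero_list_def zero_prod_def flip: single_one)

lemma basis_Cons: "basis (Node F G # H) = graft (tensor (basis F) (basis G)) * (basis H :: 'k::field bt)"
  by (simp add: graft_def tensor_def basis_mult plus_list_def)

lemmas multilinear = lin_simps bilin_simps scale_mult distrib_left distrib_right
  sc.scale_right_distrib sc.scale_left_commute

lemma graft_simps:
  "graft (x + y) = graft x + graft y" "graft (scale c x) = scale c (graft x)"
  "graft (basis (F, G)) = basis [Node F G]"
  by (simp_all add: graft_def lin_simps)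

lemma tensor_simps:
  "tensor (x + x') y = tensor x y + tensor x' y" "tensor x (y + y') = tensor x y + tensor x y'"
  "tensor (scale c x) y = scale c (tensor x y)" "tensor x (scale c y) = scale c (tensor x y)"
  "tensor (basis F) (basis G) = basis (F, G)" "tensor (basis F) 1 = basis (F, [])"
  by (simp_all add: tensor_def bilin_simps flip: basis_Nil)

lemma cograft_simps:
  "cograft (x + x') y = cograft x y + cograft x' y" "cograft x (y + y') = cograft x y + cograft x y'"
  "cograft (scale c x) y = scale c (cograft x y)" "cograft x (scale c y) = scale c (cograft x y)"
  "cograft (basis (F, G)) (basis (F', G')) = basis (F @ F', [Node G G'])"
  by (simp_all add: cograft_def bilin_simps plus_list_def)

subsection \<open>Existence and uniqueness of the coproduct\<close>

fun Delta_forest :: "forest \<Rightarrow> 'k::field bt2" where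
  "Delta_forest [] = 1"
| "Delta_forest (Node F G # H) =
     (basis ([Node F G], []) + cograft (Delta_forest F) (Delta_forest G)) * Delta_forest H"

lemma forest_induct [case_names Nil Cons]:
  assumes "P []" "\<And>F G H. P F \<Longrightarrow> P G \<Longrightarrow> P H \<Longrightarrow> P (Node F G # H)"
  shows "P F"
  using assms by (induction F rule: deg.induct) auto

lemma Delta_forest_append: "Delta_forest (F @ G) = Delta_forest F * Delta_forest G"
  by (induction F rule: deg.induct) (simp_all add: mult.assoc)

lemma is_coproduct_lin: "is_coproduct (lin Delta_forest :: 'k::field bt \<Rightarrow> 'k bt2)"
  unfolding is_coproduct_def
proof (intro conjI allI)
  show "Vector_Spaces.linear scale scale (lin Delta_forest)" by (rule linear_lin)
  show "lin Delta_forest 1 = (1 :: 'k bt2)" by (simp flip: basis_Nil)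
  fix x y :: "'k bt"
  show "lin Delta_forest (x * y) = lin Delta_forest x * (lin Delta_forest y :: 'k bt2)"
  proof (induction x rule: bt_induct)
    case (basis F)
    show ?case
      by (induction y rule: bt_induct)
        (simp_all add: basis_mult plus_list_def Delta_forest_append multilinear)
  qed (simp_all add: multilinear)
  show "lin Delta_forest (graft (tensor x y)) =
      tensor (graft (tensor x y)) 1 + cograft (lin Delta_forest x) (lin Delta_forest y)"
  proof (induction x rule: bt_induct)
    case (basis F)
    show ?case
      by (induction y rule: bt_induct)
        (simp_all add: tensor_simps graft_simps cograft_simps lin_simps sc.scale_right_distrib add_ac)
  qed (simp_all add: tensor_simps graft_simps cograft_simps lin_simps sc.scale_right_distrib add_ac)
qed

lemma is_coproduct_unique:
  assumes "is_coproduct D"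
  shows "D = lin Delta_forest"
proof
  fix x
  have 1: "D 1 = 1" and m: "\<And>x y. D (x * y) = D x * D y"
    and g: "\<And>x y. D (graft (tensor x y)) = tensor (graft (tensor x y)) 1 + cograft (D x) (D y)"
    using assms unfolding is_coproduct_def by blast+
  have eq: "D (basis F) = Delta_forest F" for F
  proof (induction F rule: forest_induct)
    case Nil
    show ?case by (simp only: basis_Nil 1 Delta_forest.simps)
  next
    case (Cons F G H)
    show ?case
      by (simp only: basis_Cons m g Cons Delta_forest.simps)
        (simp only: tensor_simps graft_simps)
  qed
  have l: "Vector_Spaces.linear scale scale D"
    using assms by (simp only: is_coproduct_def)
  show "D x = lin Delta_forest x"
    by (rule linear_basis_eq[OF l linear_lin]) (simp only: eq lin_basis)
qed

lemma Delta_eq: "Delta = lin Delta_forest"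
  unfolding Delta_def by (rule the_equality[where P = is_coproduct, OF is_coproduct_lin is_coproduct_unique])

lemma is_coproduct_Delta: "is_coproduct Delta"
  by (simp add: Delta_eq is_coproduct_lin)

lemma Delta_simps [simp]:
  "Delta (x + y) = Delta x + Delta y" "Delta (scale c x) = scale c (Delta x)"
  "Delta 1 = 1" "Delta (x * y) = Delta x * Delta y"
  using is_coproduct_Delta unfolding is_coproduct_def linear_scale_iff by blast+

lemma Delta_basis: "Delta (basis F) = Delta_forest F"
  by (simp add: Delta_eq)

subsection \<open>Grading, coassociativity and counit\<close>

definition homog2 :: "nat \<Rightarrow> 'k::field bt2 \<Rightarrow> bool" where
  "homog2 n t \<longleftrightarrow> (\<forall>(F, G)\<in>Poly_Mapping.keys t. deg F + deg G = n)"

lemma deg_append [simp]: "deg (F @ G) = deg F + deg G"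
  by (induction F rule: deg.induct) auto

lemma deg_eq_0: "deg F = 0 \<longleftrightarrow> F = []"
  by (cases F rule: deg.cases) auto

lemma homog2_mult:
  assumes "homog2 m s" "homog2 n t" shows "homog2 (m + n) (s * t)"
  unfolding homog2_def
proof
  fix p assume "p \<in> Poly_Mapping.keys (s * t)"
  then obtain x y where xy: "x \<in> Poly_Mapping.keys s" "y \<in> Poly_Mapping.keys t" "p = x + y"
    using keys_mult[of s t] by blast
  from bspec[OF assms(1)[unfolded homog2_def] xy(1)] bspec[OF assms(2)[unfolded homog2_def] xy(2)]
  show "case p of (F, G) \<Rightarrow> deg F + deg G = m + n"
    by (simp add: xy(3) plus_list_def plus_prod_def case_prod_unfold)
qed

lemma homog2_add: "homog2 n s \<Longrightarrow> homog2 n t \<Longrightarrow> homog2 n (s + t)"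
  using Poly_Mapping.keys_add[of s t] unfolding homog2_def by blast

lemma homog2_scale: "homog2 n s \<Longrightarrow> homog2 n (scale c s)"
  using keys_scale[of c s] unfolding homog2_def by blast

lemma keys_lin: "Poly_Mapping.keys (lin f x) \<subseteq> (\<Union>a\<in>Poly_Mapping.keys x. Poly_Mapping.keys (f a))"
proof
  fix b assume "b \<in> Poly_Mapping.keys (lin f x)"
  then have "(\<Sum>a\<in>Poly_Mapping.keys x. Poly_Mapping.lookup x a * Poly_Mapping.lookup (f a) b) \<noteq> 0"
    by (simp add: in_keys_iff lin_def lookup_sum)
  then obtain a where "a \<in> Poly_Mapping.keys x" "Poly_Mapping.lookup x a * Poly_Mapping.lookup (f a) b \<noteq> 0"
    by (meson sum.not_neutral_contains_not_neutral)
  then show "b \<in> (\<Union>a\<in>Poly_Mapping.keys x. Poly_Mapping.keys (f a))"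
    by (auto simp: in_keys_iff)
qed

lemma keys_bilin: "Poly_Mapping.keys (bilin f x y) \<subseteq>
    (\<Union>a\<in>Poly_Mapping.keys x. \<Union>b\<in>Poly_Mapping.keys y. Poly_Mapping.keys (f a b))"
  unfolding bilin_def by (rule order_trans[OF keys_lin]) (intro UN_mono order_refl keys_lin)

lemma homog2_cograft:
  assumes "homog2 m s" "homog2 n t" shows "homog2 (Suc (m + n)) (cograft s t)"
  unfolding homog2_def
proof
  fix p assume "p \<in> Poly_Mapping.keys (cograft s t)"
  then have "p \<in> (\<Union>x\<in>Poly_Mapping.keys s. \<Union>y\<in>Poly_Mapping.keys t.
      Poly_Mapping.keys ((case x of (a, b) \<Rightarrow> \<lambda>(c, d). basis (a + c, [Node b d]) :: 'a bt2) y))"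
    unfolding cograft_def by (rule subsetD[OF keys_bilin])
  then obtain x y where xy: "x \<in> Poly_Mapping.keys s" "y \<in> Poly_Mapping.keys t"
    "p = (fst x + fst y, [Node (snd x) (snd y)])"
    by (auto simp: case_prod_unfold)
  from bspec[OF assms(1)[unfolded homog2_def] xy(1)] bspec[OF assms(2)[unfolded homog2_def] xy(2)]
  show "case p of (F, G) \<Rightarrow> deg F + deg G = Suc (m + n)"
    by (simp add: xy(3) plus_list_def case_prod_unfold)
qed

lemma homog2_Delta_forest: "homog2 (deg F) (Delta_forest F)"
proof (induction F rule: forest_induct)
  case Nil
  show ?case by (simp add: homog2_def flip: basis_Nil2)
next
  case (Cons F G H)
  have "homog2 (Suc (deg F + deg G)) (basis ([Node F G], []))" by (simp add: homog2_def)
  with Cons show ?case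
    by (simp del: add_Suc) (intro homog2_mult homog2_add homog2_cograft)
qed

lemma bt2_induct [case_names basis add scale]:
  fixes x :: "('a \<times> 'b) \<Rightarrow>\<^sub>0 'k::field"
  assumes "\<And>a b. P (basis (a, b))"
    and "\<And>x y. P x \<Longrightarrow> P y \<Longrightarrow> P (x + y)"
    and "\<And>c x. P x \<Longrightarrow> P (scale c x)"
  shows "P x"
  using assms by (induction x rule: bt_induct) auto

definition inR :: "forest \<Rightarrow> 'k::field bt2 \<Rightarrow> (forest \<times> forest \<times> forest) \<Rightarrow>\<^sub>0 'k" where
  "inR H = lin (\<lambda>(F, G). basis (F, G, H))"

definition inL :: "forest \<Rightarrow> 'k::field bt2 \<Rightarrow> (forest \<times> forest \<times> forest) \<Rightarrow>\<^sub>0 'k" where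
  "inL H = lin (\<lambda>(F, G). basis (H, F, G))"

definition Delta_id :: "'k::field bt2 \<Rightarrow> (forest \<times> forest \<times> forest) \<Rightarrow>\<^sub>0 'k" where
  "Delta_id = lin (\<lambda>(F, G). inR G (Delta_forest F))"

definition id_Delta :: "'k::field bt2 \<Rightarrow> (forest \<times> forest \<times> forest) \<Rightarrow>\<^sub>0 'k" where
  "id_Delta = lin (\<lambda>(F, G). inL F (Delta_forest G))"

definition cograft3 where
  "cograft3 = bilin (\<lambda>(a, b, c) (a', b', c'). basis (a @ a', b @ b', [Node c c']))"

lemmas three_defs = inR_def inL_def Delta_id_def id_Delta_def cograft3_def

lemma inR_mult: "inR (F @ G) (s * t) = inR F s * inR G t"
proof (induction s rule: bt2_induct)
  case (basis p p')
  show ?case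
    by (induction t rule: bt2_induct)
      (simp_all add: inR_def multilinear basis_mult plus_list_def)
qed (simp_all add: inR_def multilinear)

lemma inL_mult: "inL (F @ G) (s * t) = inL F s * inL G t"
proof (induction s rule: bt2_induct)
  case (basis p p')
  show ?case
    by (induction t rule: bt2_induct)
      (simp_all add: inL_def multilinear basis_mult plus_list_def)
qed (simp_all add: inL_def multilinear)

lemma Delta_id_mult: "Delta_id (s * t) = Delta_id s * Delta_id t"
proof (induction s rule: bt2_induct)
  case (basis p p')
  show ?case
    by (induction t rule: bt2_induct)
      (simp_all add: Delta_id_def multilinear basis_mult plus_list_def inR_mult
        Delta_forest_append)
qed (simp_all add: Delta_id_def multilinear)

lemma id_Delta_mult: "id_Delta (s * t) = id_Delta s * id_Delta t"
proof (induction s rule: bt2_induct)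
  case (basis p p')
  show ?case
    by (induction t rule: bt2_induct)
      (simp_all add: id_Delta_def multilinear basis_mult plus_list_def inL_mult
        Delta_forest_append)
qed (simp_all add: id_Delta_def multilinear)

lemma inR_cograft: "inR [Node F G] (s * t) = cograft3 (inR F s) (inR G t)"
proof (induction s rule: bt2_induct)
  case (basis p p')
  show ?case
    by (induction t rule: bt2_induct)
      (simp_all add: inR_def cograft3_def multilinear basis_mult plus_list_def)
qed (simp_all add: inR_def cograft3_def multilinear)

lemma inL_cograft: "inL (F @ G) (cograft s t) = cograft3 (inL F s) (inL G t)"
proof (induction s rule: bt2_induct)
  case (basis p p')
  show ?case
    by (induction t rule: bt2_induct)
      (simp_all add: inL_def cograft_def cograft3_def multilinear basis_mult plus_list_def)
qed (simp_all add: inL_def cograft_def cograft3_def multilinear)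

lemma Delta_id_cograft: "Delta_id (cograft s t) = cograft3 (Delta_id s) (Delta_id t)"
proof (induction s rule: bt2_induct)
  case (basis p p')
  show ?case
    by (induction t rule: bt2_induct)
      (simp_all add: Delta_id_def cograft_def multilinear plus_list_def Delta_forest_append inR_cograft
        cograft3_def[symmetric], simp_all add: cograft3_def multilinear)
qed (simp_all add: Delta_id_def cograft_def cograft3_def multilinear)

lemma inL_add: "inL F (x + y) = inL F x + inL F y"
  by (simp add: inL_def lin_simps)

lemma inL_basis: "inL F (basis (G, H)) = basis (F, G, H)"
  by (simp add: inL_def)

lemma id_Delta_cograft:
  "id_Delta (cograft s t) = inR [] (cograft s t) + cograft3 (id_Delta s) (id_Delta t)"
proof (induction s rule: bt2_induct)
  case (basis p p')
  show ?case
  proof (induction t rule: bt2_induct)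
    case (basis q q')
    show ?case
      by
        (simp add: id_Delta_def cograft_simps inL_add inL_basis inL_cograft inR_def)
  qed (simp_all add: id_Delta_def inR_def cograft_simps cograft3_def multilinear add_ac)
qed (simp_all add: id_Delta_def inR_def cograft_simps cograft3_def multilinear add_ac)

lemma coassoc: "Delta_id (Delta_forest F) = id_Delta (Delta_forest F)"
proof (induction F rule: forest_induct)
  case Nil
  show ?case
    by (simp add: Delta_id_def id_Delta_def inR_def inL_def flip: basis_Nil2)
next
  case (Cons F G H)
  have 1: "Delta_id (x + y) = Delta_id x + Delta_id y"
    "id_Delta (x + y) = id_Delta x + id_Delta y"  "inR [] (x + y) = inR [] x + inR [] y" for x y
    by (simp_all add: Delta_id_def id_Delta_def inR_def lin_simps)
  have 2: "Delta_id (basis ([Node F G], [])) =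
      basis ([Node F G], [], []) + inR [] (cograft (Delta_forest F) (Delta_forest G))"
    by (simp add: Delta_id_def 1) (simp add: inR_def)
  have 3: "id_Delta (basis ([Node F G], [])) = basis ([Node F G], [], [])"
    by (simp add: id_Delta_def inL_def flip: basis_Nil2)
  show ?case
    by (simp add: Delta_id_mult id_Delta_mult 1 2 3 Cons Delta_id_cograft id_Delta_cograft add_ac)
qed

lemma counit_basis: "counit (basis F) = (if F = [] then 1 else 0)"
  by (auto simp: counit_def lookup_single when_def)

lemma counit_left: "lin (\<lambda>(F, G). if F = [] then basis G else 0) (Delta_forest H) = basis H"
proof (induction H rule: forest_induct)
  case Nil
  show ?case by (simp flip: basis_Nil2)
next
  case (Cons F G H)
  define e :: "'a bt2 \<Rightarrow> 'a bt" where "e = lin (\<lambda>(F, G). if F = [] then basis G else 0)"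
  have m: "e (s * t) = e s * e t" for s t
  proof (induction s rule: bt2_induct)
    case (basis p p')
    show ?case
      by (induction t rule: bt2_induct)
        (simp_all add: e_def multilinear basis_mult plus_list_def)
  qed (simp_all add: e_def multilinear)
  have c: "e (cograft s t) = bilin (\<lambda>F G. basis [Node F G]) (e s) (e t)" for s t
  proof (induction s rule: bt2_induct)
    case (basis p p')
    show ?case
      by (induction t rule: bt2_induct)
        (auto simp: e_def multilinear cograft_def plus_list_def bilin_def)
  qed (simp_all add: e_def multilinear cograft_simps)
  have "e (x + y) = e x + e y" "e (basis ([Node F G], [])) = 0" for x y
    by (simp_all add: e_def lin_simps)
  then show ?case
    using Cons unfolding e_def[symmetric]
    by (simp add: m c basis_mult plus_list_def)
qed

lemma counit_right: "lin (\<lambda>(F, G). if G = [] then basis F else 0) (Delta_forest H) = basis H"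
proof (induction H rule: forest_induct)
  case Nil
  show ?case by (simp flip: basis_Nil2)
next
  case (Cons F G H)
  define e :: "'a bt2 \<Rightarrow> 'a bt" where "e = lin (\<lambda>(F, G). if G = [] then basis F else 0)"
  have m: "e (s * t) = e s * e t" for s t
  proof (induction s rule: bt2_induct)
    case (basis p p')
    show ?case
      by (induction t rule: bt2_induct)
        (simp_all add: e_def multilinear basis_mult plus_list_def)
  qed (simp_all add: e_def multilinear)
  have c: "e (cograft s t) = 0" for s t
  proof (induction s rule: bt2_induct)
    case (basis p p')
    show ?case
      by (induction t rule: bt2_induct)
        (auto simp: e_def multilinear cograft_def plus_list_def bilin_def)
  qed (simp_all add: e_def multilinear cograft_simps)
  have "e (x + y) = e x + e y" "e (basis ([Node F G], [])) = basis [Node F G]" for x y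
    by (simp_all add: e_def lin_simps)
  then show ?case
    using Cons unfolding e_def[symmetric]
    by (simp add: m c basis_mult plus_list_def)
qed

subsection \<open>Existence and uniqueness of the antipode\<close>

definition conv :: "('k::field bt \<Rightarrow> 'k bt) \<Rightarrow> ('k bt \<Rightarrow> 'k bt) \<Rightarrow> 'k bt \<Rightarrow> 'k bt" where
  "conv S T x = lin (\<lambda>(F, G). S (basis F) * T (basis G)) (Delta x)"

lemma lin_lin: "lin f (lin g x) = lin (\<lambda>a. lin f (g a)) x"
  by (induction x rule: bt_induct) (simp_all add: lin_simps)

lemma lin_mult: "lin f x * y = lin (\<lambda>a. f a * y) x" "y * lin f x = lin (\<lambda>a. y * f a) x"
  by (induction x rule: bt_induct; simp add: multilinear)+

lemma conv_assoc: "conv (conv S T) U = conv S (conv T U)"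
proof
  fix x
  have "conv (conv S T) U (basis F) = conv S (conv T U) (basis F)" for F
  proof -
    let ?m = "lin (\<lambda>(a, b, c). S (basis a) * T (basis b) * U (basis c))"
    have "conv (conv S T) U (basis F) = ?m (Delta_id (Delta_forest F))"
      by (simp add: conv_def Delta_basis Delta_id_def lin_lin inR_def lin_mult case_prod_unfold)
    also have "\<dots> = ?m (id_Delta (Delta_forest F))"
      by (simp add: coassoc)
    also have "\<dots> = conv S (conv T U) (basis F)"
      by (simp add: conv_def Delta_basis id_Delta_def lin_lin inL_def lin_mult case_prod_unfold mult.assoc)
    finally show ?thesis .
  qed
  then show "conv (conv S T) U x = conv S (conv T U) x"
    by (induction x rule: bt_induct) (simp_all add: conv_def lin_simps)
qed

lemma conv_unit:
  assumes "Vector_Spaces.linear scale scale S"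
  shows "conv S (\<lambda>x. scale (counit x) 1) = S" "conv (\<lambda>x. scale (counit x) 1) S = S"
proof -
  have S0: "S 0 = 0"
    using assms unfolding linear_scale_iff by (metis sc.scale_zero_left)
  have l: "S (lin f x) = lin (\<lambda>a. S (f a)) x" for x :: "'b \<Rightarrow>\<^sub>0 'a" and f
    using assms by (induction x rule: bt_induct) (simp_all add: linear_scale_iff lin_simps)
  have r: "conv S (\<lambda>x. scale (counit x) 1) (basis F) = S (basis F)"
    "conv (\<lambda>x. scale (counit x) 1) S (basis F) = S (basis F)" for F
    by (subst (2) counit_right[symmetric] counit_left[symmetric];
        auto simp: l conv_def Delta_basis counit_basis S0 intro!: arg_cong[where f = "\<lambda>f. lin f _"])+
  show "conv S (\<lambda>x. scale (counit x) 1) = S" "conv (\<lambda>x. scale (counit x) 1) S = S"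
    by (rule ext, rule linear_basis_eq; simp add: assms r; simp add: linear_scale_iff conv_def lin_simps)+
qed

lemma lin_cong: "(\<And>a. a \<in> Poly_Mapping.keys x \<Longrightarrow> f a = g a) \<Longrightarrow> lin f x = lin g x"
  by (simp add: lin_def)

fun antL :: "nat \<Rightarrow> forest \<Rightarrow> 'k::field bt" where
  "antL 0 F = 0"
| "antL (Suc n) F = (if F = [] then 1 else 0)
     - lin (\<lambda>(a, b). if b = [] then 0 else antL n a * basis b) (Delta_forest F)"

fun antR :: "nat \<Rightarrow> forest \<Rightarrow> 'k::field bt" where
  "antR 0 F = 0"
| "antR (Suc n) F = (if F = [] then 1 else 0)
     - lin (\<lambda>(a, b). if a = [] then 0 else basis a * antR n b) (Delta_forest F)"

lemma keys_Delta_forest: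
  "(a, b) \<in> Poly_Mapping.keys (Delta_forest F :: 'k::field bt2) \<Longrightarrow> deg a + deg b = deg F"
  using homog2_Delta_forest[of F] unfolding homog2_def by fast

lemma antL_stable: "deg F < m \<Longrightarrow> deg F < n \<Longrightarrow> antL m F = (antL n F :: 'k::field bt)"
proof (induction m arbitrary: F n)
  case (Suc m)
  then obtain n' where n: "n = Suc n'" by (cases n) auto
  have "antL m a = (antL n' a :: 'k bt)" if "(a, b) \<in> Poly_Mapping.keys (Delta_forest F :: 'k bt2)" "b \<noteq> []" for a b
  proof (rule Suc.IH)
    show "deg a < m" "deg a < n'"
      using keys_Delta_forest[OF that(1)] that(2) Suc.prems n deg_eq_0[of b] by auto
  qed
  then have "lin (\<lambda>(a, b). if b = [] then 0 else antL m a * basis b) (Delta_forest F :: 'k bt2) =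
      lin (\<lambda>(a, b). if b = [] then 0 else antL n' a * basis b) (Delta_forest F)"
    by (intro lin_cong) auto
  then show ?case by (simp add: n)
qed simp

lemma antR_stable: "deg F < m \<Longrightarrow> deg F < n \<Longrightarrow> antR m F = (antR n F :: 'k::field bt)"
proof (induction m arbitrary: F n)
  case (Suc m)
  then obtain n' where n: "n = Suc n'" by (cases n) auto
  have "antR m b = (antR n' b :: 'k bt)" if "(a, b) \<in> Poly_Mapping.keys (Delta_forest F :: 'k bt2)" "a \<noteq> []" for a b
  proof (rule Suc.IH)
    show "deg b < m" "deg b < n'"
      using keys_Delta_forest[OF that(1)] that(2) Suc.prems n deg_eq_0[of a] by auto
  qed
  then have "lin (\<lambda>(a, b). if a = [] then 0 else basis a * antR m b) (Delta_forest F :: 'k bt2) =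
      lin (\<lambda>(a, b). if a = [] then 0 else basis a * antR n' b) (Delta_forest F)"
    by (intro lin_cong) auto
  then show ?case by (simp add: n)
qed simp

lemma antL_inverse:
  "lin (\<lambda>(a, b). antL (Suc (deg a)) a * basis b) (Delta_forest F) =
     (if F = [] then 1 else 0 :: 'k::field bt)"
proof -
  define S where "S a = (antL (Suc (deg a)) a :: 'k bt)" for a
  have "lin (\<lambda>(a, b). if b = [] then 0 else S a * basis b) (Delta_forest F) =
      lin (\<lambda>(a, b). if b = [] then 0 else antL (deg F) a * basis b) (Delta_forest F)"
    unfolding S_def
  proof (intro lin_cong, clarify)
    fix a b assume k: "(a, b) \<in> Poly_Mapping.keys (Delta_forest F :: 'k bt2)"
    have "antL (Suc (deg a)) a = (antL (deg F) a :: 'k bt)" if "b \<noteq> []"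
      using keys_Delta_forest[OF k] deg_eq_0[of b] that by (intro antL_stable) auto
    then show "(if b = [] then 0 else antL (Suc (deg a)) a * basis b) =
        (if b = [] then 0 else antL (deg F) a * basis b :: 'k bt)" by simp
  qed
  then have S: "S F = (if F = [] then 1 else 0)
      - lin (\<lambda>(a, b). if b = [] then 0 else S a * basis b) (Delta_forest F)"
    by (simp add: S_def[of F])
  have "S F = lin S (lin (\<lambda>(a, b). if b = [] then basis a else 0) (Delta_forest F))"
    by (simp add: counit_right)
  also have "\<dots> = lin (\<lambda>(a, b). if b = [] then S a else 0) (Delta_forest F)"
    unfolding lin_lin by (intro lin_cong) auto
  finally have "S F + lin (\<lambda>(a, b). if b = [] then 0 else S a * basis b) (Delta_forest F) =
      lin (\<lambda>(a, b). S a * basis b) (Delta_forest F)"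
    by (simp flip: lin_fun_add) (auto simp: basis_Nil intro!: lin_cong)
  then show ?thesis using S by (simp add: S_def)
qed

lemma antR_inverse:
  "lin (\<lambda>(a, b). basis a * antR (Suc (deg b)) b) (Delta_forest F) =
     (if F = [] then 1 else 0 :: 'k::field bt)"
proof -
  define S where "S a = (antR (Suc (deg a)) a :: 'k bt)" for a
  have "lin (\<lambda>(a, b). if a = [] then 0 else basis a * S b) (Delta_forest F) =
      lin (\<lambda>(a, b). if a = [] then 0 else basis a * antR (deg F) b) (Delta_forest F)"
    unfolding S_def
  proof (intro lin_cong, clarify)
    fix a b assume k: "(a, b) \<in> Poly_Mapping.keys (Delta_forest F :: 'k bt2)"
    have "antR (Suc (deg b)) b = (antR (deg F) b :: 'k bt)" if "a \<noteq> []"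
      using keys_Delta_forest[OF k] deg_eq_0[of a] that by (intro antR_stable) auto
    then show "(if a = [] then 0 else basis a * antR (Suc (deg b)) b) =
        (if a = [] then 0 else basis a * antR (deg F) b :: 'k bt)" by simp
  qed
  then have S: "S F = (if F = [] then 1 else 0)
      - lin (\<lambda>(a, b). if a = [] then 0 else basis a * S b) (Delta_forest F)"
    by (simp add: S_def[of F])
  have "S F = lin S (lin (\<lambda>(a, b). if a = [] then basis b else 0) (Delta_forest F))"
    by (simp add: counit_left)
  also have "\<dots> = lin (\<lambda>(a, b). if a = [] then S b else 0) (Delta_forest F)"
    unfolding lin_lin by (intro lin_cong) auto
  finally have "S F + lin (\<lambda>(a, b). if a = [] then 0 else basis a * S b) (Delta_forest F) =
      lin (\<lambda>(a, b). basis a * S b) (Delta_forest F)"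
    by (simp flip: lin_fun_add) (auto simp: basis_Nil intro!: lin_cong)
  then show ?thesis using S by (simp add: S_def)
qed

lemma is_antipode_iff:
  "is_antipode S \<longleftrightarrow> Vector_Spaces.linear scale scale S \<and>
     conv S (\<lambda>x. x) = (\<lambda>x. scale (counit x) 1) \<and> conv (\<lambda>x. x) S = (\<lambda>x. scale (counit x) 1)"
  by (simp add: is_antipode_def conv_def fun_eq_iff)

lemma ex1_antipode: "\<exists>!S :: 'k::field bt \<Rightarrow> 'k bt. is_antipode S"
proof -
  let ?u = "\<lambda>x :: 'k bt. scale (counit x) (1 :: 'k bt)"
  have eq: "S = T" if "Vector_Spaces.linear scale scale S" "Vector_Spaces.linear scale scale T"
    "conv S (\<lambda>x. x) = ?u" "conv (\<lambda>x. x) T = ?u" for S T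
    using conv_assoc[of S "\<lambda>x. x" T] that conv_unit by metis
  define S T :: "'k bt \<Rightarrow> 'k bt"
    where "S = lin (\<lambda>F. antL (Suc (deg F)) F)" and "T = lin (\<lambda>F. antR (Suc (deg F)) F)"
  have u: "Vector_Spaces.linear scale scale ?u"
    by (simp add: linear_scale_iff counit_def lookup_add sc.scale_left_distrib)
  have c: "Vector_Spaces.linear scale scale (conv f g :: 'k bt \<Rightarrow> 'k bt)" for f g
    by (simp add: linear_scale_iff conv_def lin_simps)
  have S: "conv S (\<lambda>x. x) = ?u"
    by (rule ext, rule linear_basis_eq[OF c u])
      (simp add: conv_def S_def Delta_basis antL_inverse counit_basis del: antL.simps)
  have T: "conv (\<lambda>x. x) T = ?u"
    by (rule ext, rule linear_basis_eq[OF c u])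
      (simp add: conv_def T_def Delta_basis antR_inverse counit_basis del: antR.simps)
  have lin: "Vector_Spaces.linear scale scale S" "Vector_Spaces.linear scale scale T"
    by (simp_all add: S_def T_def linear_lin)
  have "S = T" by (rule eq[OF lin S T])
  with S T lin have "is_antipode S" by (simp add: is_antipode_iff)
  then show ?thesis using eq by (auto simp: is_antipode_iff)
qed

lemma is_antipode_antipode: "is_antipode antipode"
  unfolding antipode_def by (rule theI'[OF ex1_antipode])

subsection \<open>Existence and uniqueness of \<open>Phi\<close>\<close>

definition lin_form :: "('a \<Rightarrow> 'k::field) \<Rightarrow> ('a \<Rightarrow>\<^sub>0 'k) \<Rightarrow> 'k" where
  "lin_form w x = (\<Sum>a\<in>Poly_Mapping.keys x. Poly_Mapping.lookup x a * w a)"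

lemma lin_form_lin: "lin_form w x = Poly_Mapping.lookup (lin (\<lambda>a. scale (w a) (basis ())) x) ()"
  by (simp add: lin_form_def lin_def lookup_sum)

lemma lin_form_simps:
  "lin_form w (x + y) = lin_form w x + lin_form w y"
  "lin_form w (scale c x) = c * lin_form w x"
  "lin_form w (basis a) = w a"
  by (simp_all add: lin_form_lin lin_simps lookup_add)

lemma lin_form_fun:
  "lin_form (\<lambda>a. w a + v a) x = lin_form w x + lin_form v x"
  "lin_form (\<lambda>a. c * w a) x = c * lin_form w x"
  by (simp_all add: lin_form_def sum.distrib sum_distrib_left algebra_simps)

lemma lin_form_eq_0: "(\<And>a. a \<in> Poly_Mapping.keys x \<Longrightarrow> w a = 0) \<Longrightarrow> lin_form w x = 0"
  by (simp add: lin_form_def)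

lemma lin_form_linear: "Vector_Spaces.linear scale (*) (lin_form w)"
  by (simp add: linear_form_iff lin_form_simps)

lemma linear_form_expand:
  assumes "Vector_Spaces.linear scale (*) f"
  shows "f x = lin_form (\<lambda>a. f (basis a)) x"
  by (rule linear_form_basis_eq[OF assms lin_form_linear]) (simp add: lin_form_simps)

lemma lin_form_lin_comp: "lin_form w (lin f x) = lin_form (\<lambda>a. lin_form w (f a)) x"
  by (induction x rule: bt_induct) (simp_all add: lin_form_simps lin_simps)

lemma tensor_form_eq: "tensor_form f g = lin_form (\<lambda>(F, G). f (basis F) * g (basis G))"
  by (simp add: tensor_form_def lin_form_def fun_eq_iff case_prod_unfold)

lemma linear_dual_mult: "Vector_Spaces.linear scale (*) (dual_mult f g)"
  by (simp add: linear_form_iff dual_mult_def tensor_form_eq lin_form_simps)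

lemma linear_Gamma_star: "Vector_Spaces.linear scale (*) (Gamma_star f g)"
  by (simp add: linear_form_iff Gamma_star_def Gamma_def tensor_form_eq lin_simps lin_form_simps)

lemma linear_counit: "Vector_Spaces.linear scale (*) counit"
  by (simp add: linear_form_iff counit_def lookup_add)

lemma dual_mult_assoc: "dual_mult (dual_mult f g) h = dual_mult f (dual_mult g h)"
proof (rule ext, rule linear_form_basis_eq[OF linear_dual_mult linear_dual_mult])
  fix F
  let ?m = "lin_form (\<lambda>(a, b, c). f (basis a) * g (basis b) * h (basis c))"
  have "dual_mult (dual_mult f g) h (basis F) = ?m (Delta_id (Delta_forest F))"
    by (simp add: dual_mult_def Delta_basis Delta_id_def tensor_form_eq lin_form_lin_comp inR_def
        lin_form_simps case_prod_unfold mult.commute[of _ "h _"] flip: lin_form_fun)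
  also have "\<dots> = ?m (id_Delta (Delta_forest F))"
    by (simp add: coassoc)
  also have "\<dots> = dual_mult f (dual_mult g h) (basis F)"
    by (simp add: dual_mult_def Delta_basis id_Delta_def tensor_form_eq lin_form_lin_comp inL_def
        lin_form_simps case_prod_unfold mult.assoc flip: lin_form_fun)
  finally show "dual_mult (dual_mult f g) h (basis F) = dual_mult f (dual_mult g h) (basis F)" .
qed

lemma dual_mult_counit:
  assumes f: "Vector_Spaces.linear scale (*) f"
  shows "dual_mult f counit = f" "dual_mult counit f = f"
proof -
  have 0: "f 0 = 0" using linear_form_expand[OF f, of 0] by (simp add: lin_form_def)
  have l: "f (lin h x) = lin_form (\<lambda>a. f (h a)) x" for x :: "'b \<Rightarrow>\<^sub>0 'a" and h
    using f by (induction x rule: bt_induct) (simp_all add: linear_form_iff lin_simps lin_form_simps)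
  have r: "dual_mult f counit (basis F) = f (basis F)" "dual_mult counit f (basis F) = f (basis F)" for F
    by (subst (2) counit_right[symmetric] counit_left[symmetric];
        auto simp: l dual_mult_def tensor_form_eq Delta_basis counit_basis 0
          intro!: arg_cong[where f = "\<lambda>f. lin_form f _"])+
  show "dual_mult f counit = f" "dual_mult counit f = f"
    by (rule ext, rule linear_form_basis_eq[OF linear_dual_mult f]; simp add: r)+
qed

fun Phi_forest :: "forest \<Rightarrow> 'k::field bt \<Rightarrow> 'k" where
  "Phi_forest [] = counit"
| "Phi_forest (Node F G # H) = dual_mult (Gamma_star (Phi_forest F) (Phi_forest G)) (Phi_forest H)"

lemma linear_Phi_forest: "Vector_Spaces.linear scale (*) (Phi_forest F)"
  by (cases F rule: deg.cases) (simp_all add: linear_counit linear_dual_mult)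

lemma Phi_forest_append: "Phi_forest (F @ G) = dual_mult (Phi_forest F) (Phi_forest G)"
  by (induction F rule: forest_induct)
    (simp_all add: dual_mult_counit linear_Phi_forest dual_mult_assoc)

lemma Gamma_basis:
  "Gamma (basis F) = (if F = [] then 0 else Delta_forest (butlast F) * gamma (last F) :: 'k::field bt2)"
proof -
  have "prod_list (map (\<lambda>t. Delta (basis [t])) F) = (Delta_forest F :: 'k bt2)" for F
  proof (induction F)
    case (Cons t F)
    have "Delta (basis [t]) * Delta_forest F = (Delta_forest (t # F) :: 'k bt2)"
      by (simp only: Delta_basis Delta_forest_append[symmetric] append.simps)
    with Cons show ?case by simp
  qed simp
  then show ?thesis by (simp add: Gamma_def)
qed

lemma keys_Gamma_basis:
  assumes "(a, b) \<in> Poly_Mapping.keys (Gamma (basis F) :: 'k::field bt2)"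
  shows "Suc (deg a + deg b) = deg F"
proof (cases F rule: rev_cases)
  case Nil
  with assms show ?thesis by (simp add: Gamma_basis)
next
  case (snoc E t)
  obtain G H where t: "t = Node G H" by (cases t)
  have "homog2 (deg G + deg H) (gamma t :: 'k bt2)"
    unfolding t by (simp, rule homog2_scale) (simp add: homog2_def)
  with homog2_mult[OF homog2_Delta_forest this] assms have "deg a + deg b = deg E + (deg G + deg H)"
    by (fastforce simp: Gamma_basis snoc homog2_def)
  then show ?thesis by (simp add: snoc t)
qed

lemma Phi_forest_degree: "deg G \<noteq> deg F \<Longrightarrow> Phi_forest F (basis G :: 'k::field bt) = 0"
proof (induction F arbitrary: G rule: forest_induct)
  case Nil
  then show ?case using deg_eq_0 by (auto simp: counit_basis)
next
  case (Cons F F' H)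
  have 1: "Gamma_star (Phi_forest F) (Phi_forest F') (basis E :: 'k bt) = 0"
    if "deg E \<noteq> Suc (deg F + deg F')" for E
    unfolding Gamma_star_def tensor_form_eq
  proof (rule lin_form_eq_0, clarify)
    fix a b assume "(a, b) \<in> Poly_Mapping.keys (Gamma (basis E) :: 'k bt2)"
    from keys_Gamma_basis[OF this] that have "deg a \<noteq> deg F \<or> deg b \<noteq> deg F'" by auto
    then show "Phi_forest F (basis a) * Phi_forest F' (basis b) = (0 :: 'k)"
      using Cons.IH by auto
  qed
  show ?case
    unfolding dual_mult_def tensor_form_eq Phi_forest.simps Delta_basis
  proof (rule lin_form_eq_0, clarify)
    fix a b assume "(a, b) \<in> Poly_Mapping.keys (Delta_forest G :: 'k bt2)"
    from keys_Delta_forest[OF this] Cons.prems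
    have "deg a \<noteq> Suc (deg F + deg F') \<or> deg b \<noteq> deg H" by auto
    then show "Gamma_star (Phi_forest F) (Phi_forest F') (basis a) * Phi_forest H (basis b) = (0 :: 'k)"
      using 1 Cons.IH(3) by auto
  qed
qed

lemma dual_mult_simps:
  "dual_mult (\<lambda>z. f z + f' z) g = (\<lambda>z. dual_mult f g z + dual_mult f' g z)"
  "dual_mult f (\<lambda>z. g z + g' z) = (\<lambda>z. dual_mult f g z + dual_mult f g' z)"
  "dual_mult (\<lambda>z. c * f z) g = (\<lambda>z. c * dual_mult f g z)"
  "dual_mult f (\<lambda>z. c * g z) = (\<lambda>z. c * dual_mult f g z)"
  by (simp_all add: dual_mult_def tensor_form_eq case_prod_unfold algebra_simps
      flip: lin_form_fun)

lemma Gamma_star_simps: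
  "Gamma_star (\<lambda>z. f z + f' z) g = (\<lambda>z. Gamma_star f g z + Gamma_star f' g z)"
  "Gamma_star f (\<lambda>z. g z + g' z) = (\<lambda>z. Gamma_star f g z + Gamma_star f g' z)"
  "Gamma_star (\<lambda>z. c * f z) g = (\<lambda>z. c * Gamma_star f g z)"
  "Gamma_star f (\<lambda>z. c * g z) = (\<lambda>z. c * Gamma_star f g z)"
  by (simp_all add: Gamma_star_def tensor_form_eq case_prod_unfold algebra_simps
      flip: lin_form_fun)

lemma ex1_Phi: "\<exists>!\<phi> :: 'k::field bt \<Rightarrow> 'k bt \<Rightarrow> 'k. is_Phi \<phi>"
proof (rule ex1I)
  define \<phi> :: "'k bt \<Rightarrow> 'k bt \<Rightarrow> 'k" where "\<phi> = (\<lambda>x z. lin_form (\<lambda>F. Phi_forest F z) x)"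
  have b: "\<phi> (basis F) = Phi_forest F" for F
    by (simp add: \<phi>_def lin_form_simps)
  have s: "\<phi> (x + y) = (\<lambda>z. \<phi> x z + \<phi> y z)" "\<phi> (scale c x) = (\<lambda>z. c * \<phi> x z)" for x y c
    by (simp_all add: \<phi>_def lin_form_simps)
  have l: "Vector_Spaces.linear scale (*) (\<phi> x)" for x
    by (induction x rule: bt_induct)
      (simp_all add: b s linear_Phi_forest, simp_all add: linear_form_iff algebra_simps)
  show "is_Phi \<phi>"
    unfolding is_Phi_def
  proof (intro conjI allI)
    fix x y z :: "'k bt"
    have "\<phi> x w = 0" if "homogeneous n w" "n \<notin> deg ` Poly_Mapping.keys x" for n w
      unfolding linear_form_expand[OF l, of x w]
    proof (rule lin_form_eq_0)
      fix G assume "G \<in> Poly_Mapping.keys w"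
      with that show "\<phi> x (basis G) = 0"
        unfolding \<phi>_def homogeneous_def by (intro lin_form_eq_0 Phi_forest_degree) auto
    qed
    then have "{n. \<exists>w. homogeneous n w \<and> \<phi> x w \<noteq> 0} \<subseteq> deg ` Poly_Mapping.keys x" by blast
    then show "\<phi> x \<in> graded_dual"
      by (simp add: graded_dual_def l finite_subset)
    show "Vector_Spaces.linear scale (*) (\<lambda>x. \<phi> x z)"
      by (simp add: linear_form_iff s)
    show "\<phi> 1 = counit" using b[of "[]"] by (simp add: basis_Nil)
    show "\<phi> (x * y) = dual_mult (\<phi> x) (\<phi> y)"
    proof (induction x rule: bt_induct)
      case (basis F)
      show ?case
        by (induction y rule: bt_induct)
          (simp_all add: basis_mult plus_list_def b s Phi_forest_append multilinear dual_mult_simps)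
    qed (simp_all add: s multilinear dual_mult_simps)
    show "\<phi> (graft (tensor x y)) = Gamma_star (\<phi> x) (\<phi> y)"
    proof (induction x rule: bt_induct)
      case (basis F)
      show ?case
        by (induction y rule: bt_induct)
          (simp_all add: tensor_simps graft_simps b s dual_mult_counit linear_Gamma_star Gamma_star_simps)
    qed (simp_all add: s tensor_simps graft_simps Gamma_star_simps)
  qed
  fix \<psi> :: "'k bt \<Rightarrow> 'k bt \<Rightarrow> 'k" assume psi: "is_Phi \<psi>"
  have 1: "\<psi> 1 = counit" and m: "\<And>x y. \<psi> (x * y) = dual_mult (\<psi> x) (\<psi> y)"
    and g: "\<And>x y. \<psi> (graft (tensor x y)) = Gamma_star (\<psi> x) (\<psi> y)"
    and l: "\<And>z. Vector_Spaces.linear scale (*) (\<lambda>x. \<psi> x z)"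
    using psi unfolding is_Phi_def by blast+
  have eq: "\<psi> (basis F) = Phi_forest F" for F
    by (induction F rule: forest_induct)
      (simp_all only: basis_Nil 1 basis_Cons m g Phi_forest.simps)
  show "\<psi> = \<phi>"
  proof (intro ext)
    fix x z
    have l': "Vector_Spaces.linear scale (*) (\<lambda>x. \<phi> x z)"
      by (simp add: linear_form_iff s)
    show "\<psi> x z = \<phi> x z"
      by (rule linear_form_basis_eq[OF l l']) (simp only: eq b)
  qed
qed

lemma is_Phi_Phi: "is_Phi Phi"
  unfolding Phi_def by (rule theI'[OF ex1_Phi])

end

theory Submission
  imports Defs
begin

text \<open>
  The first three properties are the recursive description of \<open>\<Phi>\<close>, and the fifth
  holds because \<open>\<Delta>\<close> preserves the degree, while \<open>\<Gamma>\<close> lowers it by one and \<open>B\<close> raises it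
  by one.  The heart of the matter is symmetry.  The recursion determines the pairing from the
  first argument: a product on the left becomes \<open>\<Delta>\<close> on the right, and \<open>B\<close> on the left
  becomes \<open>\<Gamma>\<close> on the right.  If the same two rules hold with the arguments exchanged, then
  the pairing and its transpose satisfy one recursion and coincide (\<open>forest_pairing_sym\<close>).

  The first transposed rule, \<open>\<langle>x, yz\<rangle> = \<Sum> \<langle>x\<^sup>1, y\<rangle>\<langle>x\<^sup>2, z\<rangle>\<close>
  (\<open>coproduct_adjoint_forest_pairing\<close>), is proved by induction on \<open>x\<close>.  It passes to
  products since \<open>\<Delta>\<close> is multiplicative, and to \<open>B(x \<otimes> x')\<close> since
  \<open>\<Gamma>(yz) = \<Delta>(y)\<Gamma>(z) + \<epsilon>(z)\<Gamma>(y)\<close> mirrors the two summands of \<open>\<Delta>(B(x \<otimes> x'))\<close>.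
  The second one, \<open>\<langle>x, B(y \<otimes> z)\<rangle> = \<langle>\<Gamma>(x), y \<otimes> z\<rangle>\<close>
  (\<open>forest_pairing_Node_right\<close>), follows for \<open>x \<noteq> 1\<close> by writing \<open>x = ut\<close> with \<open>t\<close> the last tree.
  Expanding \<open>\<Delta>(B(y \<otimes> z))\<close>, the first rule turns the factors with \<open>u\<close> into
  \<open>\<Delta>(u)\<close>, and the factors with \<open>t\<close> give \<open>\<gamma>(t)\<close>, so the product is
  \<open>\<Delta>(u)\<gamma>(t) = \<Gamma>(x)\<close>.  Between two trees \<open>B(F \<otimes> G)\<close> and \<open>B(F' \<otimes> G')\<close> the signs \<open>(-1)^|G'|\<close>
  from the right argument and \<open>(-1)^|G|\<close> from the left one agree wherever \<open>\<langle>G, G'\<rangle>\<close> does not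
  vanish, since the pairing vanishes on different degrees.

  The pairing is then a Hopf pairing on both sides, and \<open>\<langle>S(x), y\<rangle>\<close> and
  \<open>\<langle>x, S(y)\<rangle>\<close> are a left and a right inverse of it for convolution, hence equal.
\<close>

section \<open>Linear forms on forests and pairs of forests\<close>

lemma lin_form_cong:
  "(\<And>a. a \<in> Poly_Mapping.keys x \<Longrightarrow> v a = w a) \<Longrightarrow> lin_form v x = lin_form w x"
  by (simp add: lin_form_def)

lemma lin_form_0 [simp]: "lin_form w 0 = 0"
  by (simp add: lin_form_def)

lemma linear_form_lin:
  assumes "Vector_Spaces.linear scale (*) f"
  shows "f (lin h x) = lin_form (\<lambda>a. f (h a)) x"
  using assms by (induction x rule: bt_induct) (simp_all add: linear_form_iff lin_simps lin_form_simps)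

lemma lin_form_mult:
  fixes s t :: "'k::field bt2"
  shows "lin_form w (s * t) = lin_form (\<lambda>(a, b). lin_form (\<lambda>(c, d). w (a @ c, b @ d)) t) s"
proof (induction s rule: bt2_induct)
  case (basis a b)
  show ?case
    by (induction t rule: bt2_induct)
      (simp_all add: basis_mult plus_list_def multilinear lin_form_simps)
qed (simp_all add: multilinear lin_form_simps)

lemma lin_form_cograft:
  "lin_form w (cograft s t) = lin_form (\<lambda>(a, b). lin_form (\<lambda>(c, d). w (a @ c, [Node b d])) t) s"
proof (induction s rule: bt2_induct)
  case (basis a b)
  show ?case
    by (induction t rule: bt2_induct) (simp_all add: cograft_simps lin_form_simps)
qed (simp_all add: cograft_simps lin_form_simps)

text \<open>
  The product form \<open>\<beta> \<otimes> \<beta>\<close>, with the pure tensor \<open>a \<otimes> b\<close> held fixed on the left.  The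
  bilinear function \<open>\<beta>\<close> is arbitrary because both the pairing and its transpose are needed.
\<close>

definition tensor_pairing :: "(forest \<Rightarrow> forest \<Rightarrow> 'k::field) \<Rightarrow> forest \<Rightarrow> forest \<Rightarrow> 'k bt2 \<Rightarrow> 'k" where
  "tensor_pairing \<beta> a b = lin_form (\<lambda>(c, d). \<beta> a c * \<beta> b d)"

lemma tensor_pairing_simps:
  "tensor_pairing \<beta> a b (s + t) = tensor_pairing \<beta> a b s + tensor_pairing \<beta> a b t"
  "tensor_pairing \<beta> a b (scale k s) = k * tensor_pairing \<beta> a b s"
  "tensor_pairing \<beta> a b (basis (c, d)) = \<beta> a c * \<beta> b d"
  "tensor_pairing \<beta> a b 0 = 0"
  by (simp_all add: tensor_pairing_def lin_form_simps)

definition coproduct_adjoint :: "(forest \<Rightarrow> forest \<Rightarrow> 'k::field) \<Rightarrow> forest \<Rightarrow> bool" where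
  "coproduct_adjoint \<beta> a \<longleftrightarrow>
     (\<forall>c d. \<beta> a (c @ d) = lin_form (\<lambda>(a1, a2). \<beta> a1 c * \<beta> a2 d) (Delta_forest a))"

lemma coproduct_adjointD:
  "coproduct_adjoint \<beta> a \<Longrightarrow>
     \<beta> a (c @ d) = lin_form (\<lambda>(a1, a2). \<beta> a1 c * \<beta> a2 d) (Delta_forest a)"
  by (simp add: coproduct_adjoint_def)

lemma lin_form_sum_product:
  "lin_form (\<lambda>p. lin_form (\<lambda>q. f p * g q) y) x = lin_form f x * lin_form g y"
  by (simp add: lin_form_fun mult.commute[of _ "lin_form g y"])

text \<open>
  If product and coproduct are adjoint for \<open>\<beta>\<close>, then so are the product and the coproduct of
  the tensor square for \<open>\<beta> \<otimes> \<beta>\<close>.  The middle interchange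
  \<open>(a\<^sup>1 \<otimes> b\<^sup>1) \<otimes> (a\<^sup>2 \<otimes> b\<^sup>2)\<close> is what groups the four factors.  Applied to the
  pairing this treats \<open>\<Delta>(y)\<Gamma>(z)\<close>, and applied to its transpose it treats
  \<open>\<Delta>(u)\<gamma>(t)\<close>.
\<close>

lemma tensor_pairing_mult:
  fixes s t :: "'k::field bt2"
  assumes a: "coproduct_adjoint \<beta> a" and b: "coproduct_adjoint \<beta> b"
  shows "tensor_pairing \<beta> a b (s * t) =
    lin_form (\<lambda>(a1, a2). lin_form (\<lambda>(b1, b2). tensor_pairing \<beta> a1 b1 s * tensor_pairing \<beta> a2 b2 t)
      (Delta_forest b)) (Delta_forest a)"
proof (induction s rule: bt2_induct)
  case (basis c d)
  show ?case
  proof (induction t rule: bt2_induct)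
    case (basis c' d')
    have "tensor_pairing \<beta> a b (basis (c, d) * basis (c', d')) = \<beta> a (c @ c') * \<beta> b (d @ d')"
      by (simp add: basis_mult plus_list_def tensor_pairing_simps)
    also have "\<dots> = lin_form (\<lambda>p. lin_form (\<lambda>q.
        (case p of (a1, a2) \<Rightarrow> \<beta> a1 c * \<beta> a2 c') * (case q of (b1, b2) \<Rightarrow> \<beta> b1 d * \<beta> b2 d'))
        (Delta_forest b)) (Delta_forest a)"
      using a b by (simp add: coproduct_adjoint_def lin_form_sum_product)
    finally show ?case
      by (simp add: tensor_pairing_simps case_prod_unfold mult_ac)
  qed (simp_all add: multilinear tensor_pairing_simps case_prod_unfold lin_form_fun mult.left_commute)
qed (simp_all add: multilinear tensor_pairing_simps case_prod_unfold lin_form_fun mult.assoc)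

section \<open>Symmetry of the pairing\<close>

lemma Phi_basis: "Phi (basis F) = Phi_forest F"
proof -
  have 1: "Phi 1 = counit" and m: "\<And>x y. Phi (x * y) = dual_mult (Phi x) (Phi y)"
    and g: "\<And>x y. Phi (graft (tensor x y)) = Gamma_star (Phi x) (Phi y)"
    using is_Phi_Phi unfolding is_Phi_def by blast+
  show ?thesis
    by (induction F rule: forest_induct)
      (simp_all only: basis_Nil 1 basis_Cons m g Phi_forest.simps)
qed

definition forest_pairing :: "forest \<Rightarrow> forest \<Rightarrow> 'k::field" where
  "forest_pairing F G = Phi_forest F (basis G)"

lemma forest_pairing_Nil: "forest_pairing [] F = (if F = [] then 1 else 0)"
  by (simp add: forest_pairing_def counit_basis)

lemma forest_pairing_append: "forest_pairing (F @ G) H = tensor_pairing forest_pairing F G (Delta_forest H)"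
  by (simp add: forest_pairing_def Phi_forest_append dual_mult_def tensor_form_eq tensor_pairing_def Delta_basis)

lemma forest_pairing_Node: "forest_pairing [Node F G] H = tensor_pairing forest_pairing F G (Gamma (basis H))"
  by (simp add: forest_pairing_def dual_mult_counit linear_Gamma_star)
    (simp add: forest_pairing_def tensor_pairing_def Gamma_star_def tensor_form_eq)

lemma forest_pairing_degree: "deg G \<noteq> deg F \<Longrightarrow> forest_pairing F G = 0"
  by (simp add: forest_pairing_def Phi_forest_degree)

lemma forest_pairing_Nil_right: "forest_pairing F [] = (if F = [] then 1 else 0)"
  by (cases "F = []") (simp_all add: forest_pairing_Nil forest_pairing_degree deg_eq_0)

text \<open>
  The last term is \<open>\<epsilon>(G)\<Gamma>(F)\<close>: when \<open>G\<close> is empty the last tree of the product, on which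
  \<open>\<gamma>\<close> acts, is that of \<open>F\<close>.
\<close>

lemma Gamma_append:
  "Gamma (basis (F @ G)) = Delta_forest F * Gamma (basis G) + (if G = [] then Gamma (basis F) else 0)"
  by (cases G rule: rev_cases)
    (simp_all add: Gamma_basis Delta_forest_append mult.assoc butlast_append flip: append_assoc)

lemma coproduct_adjoint_forest_pairing_append:
  assumes "coproduct_adjoint (forest_pairing :: _ \<Rightarrow> _ \<Rightarrow> 'k::field) F"
    "coproduct_adjoint (forest_pairing :: _ \<Rightarrow> _ \<Rightarrow> 'k) G"
  shows "coproduct_adjoint (forest_pairing :: _ \<Rightarrow> _ \<Rightarrow> 'k) (F @ G)"
  by (simp add: coproduct_adjoint_def forest_pairing_append Delta_forest_append tensor_pairing_mult[OF assms]
      lin_form_mult case_prod_unfold)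

text \<open>
  With \<open>x = B(F \<otimes> G)\<close>, the two terms of \<open>\<Gamma>(cd) = \<Delta>(c)\<Gamma>(d) + \<epsilon>(d)\<Gamma>(c)\<close> match those of
  \<open>\<Delta>(x) = x \<otimes> 1 + \<Sum> F\<^sup>1G\<^sup>1 \<otimes> B(F\<^sup>2 \<otimes> G\<^sup>2)\<close>: pairing \<open>\<Delta>(c)\<close> with
  \<open>F\<^sup>1 \<otimes> G\<^sup>1\<close> is pairing \<open>c\<close> with \<open>F\<^sup>1G\<^sup>1\<close>, and pairing \<open>\<Gamma>(d)\<close> with
  \<open>F\<^sup>2 \<otimes> G\<^sup>2\<close> is pairing \<open>d\<close> with \<open>B(F\<^sup>2 \<otimes> G\<^sup>2)\<close>.
\<close>

lemma coproduct_adjoint_forest_pairing_Node: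
  assumes "coproduct_adjoint (forest_pairing :: _ \<Rightarrow> _ \<Rightarrow> 'k::field) F"
    "coproduct_adjoint (forest_pairing :: _ \<Rightarrow> _ \<Rightarrow> 'k) G"
  shows "coproduct_adjoint (forest_pairing :: _ \<Rightarrow> _ \<Rightarrow> 'k) [Node F G]"
proof -
  have "forest_pairing [Node F G] (c @ d) =
      (lin_form (\<lambda>(a, b). forest_pairing a c * forest_pairing b d) (Delta_forest [Node F G]) :: 'k)" for c d
  proof -
    have "forest_pairing [Node F G] (c @ d) = (tensor_pairing forest_pairing F G (Delta_forest c * Gamma (basis d))
        + forest_pairing [Node F G] c * forest_pairing [] d :: 'k)"
      by (simp add: forest_pairing_Node Gamma_append tensor_pairing_simps forest_pairing_Nil)
    then show ?thesis
      by (simp add: tensor_pairing_mult[OF assms] lin_form_simps lin_form_cograft case_prod_unfold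
          forest_pairing_append forest_pairing_Node)
  qed
  then show ?thesis
    by (simp add: coproduct_adjoint_def)
qed

lemma coproduct_adjoint_forest_pairing: "coproduct_adjoint (forest_pairing :: _ \<Rightarrow> _ \<Rightarrow> 'k::field) F"
proof (induction F rule: forest_induct)
  case Nil
  show ?case
    by (simp add: coproduct_adjoint_def forest_pairing_Nil lin_form_simps flip: basis_Nil2)
next
  case (Cons F G H)
  then show ?case
    using coproduct_adjoint_forest_pairing_append[OF coproduct_adjoint_forest_pairing_Node, of F G H] by simp
qed

lemma coproduct_adjoint_forest_pairing_transpose: "coproduct_adjoint (\<lambda>F G. forest_pairing G F) F"
  by (simp add: coproduct_adjoint_def forest_pairing_append tensor_pairing_def)

text \<open>
  The definition of \<open>\<gamma>\<close> gives the sign \<open>(-1)^|G'|\<close> of the right argument.  It may be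
  replaced by that of the left argument, since \<open>\<langle>G, G'\<rangle> = 0\<close> unless \<open>|G| = |G'|\<close>; this
  is where the symmetry of the pairing starts.
\<close>

lemma forest_pairing_Node_Node:
  "forest_pairing [Node F G] [Node F' G'] =
     (-1) ^ deg G * (forest_pairing F F' * forest_pairing G G')"
  by (cases "deg G = deg G'")
    (simp_all add: forest_pairing_Node Gamma_basis tensor_pairing_simps forest_pairing_degree)

text \<open>
  Grafting in the second argument is adjoint to \<open>\<Gamma>\<close>.  Together with
  \<open>coproduct_adjoint_forest_pairing\<close> it says that the transposed pairing obeys the recursion
  that determines the pairing.
\<close>

lemma forest_pairing_Node_right:
  "forest_pairing H [Node F G] =
     (tensor_pairing (\<lambda>F G. forest_pairing G F) F G (Gamma (basis H)) :: 'k::field)"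
proof (cases H rule: rev_cases)
  case Nil
  then show ?thesis by (simp add: forest_pairing_Nil Gamma_basis tensor_pairing_def)
next
  case (snoc E t)
  obtain F' G' where t: "t = Node F' G'" by (cases t)
  have g: "tensor_pairing (\<lambda>F G. forest_pairing G F) a b (gamma t) =
      (forest_pairing [t] [Node a b] :: 'k)" for a b
    by (simp add: t forest_pairing_Node_Node tensor_pairing_simps)
  have d: "tensor_pairing (\<lambda>F G. forest_pairing G F) a b (Delta_forest E) =
      (forest_pairing E (a @ b) :: 'k)" for a b
    by (simp add: tensor_pairing_def coproduct_adjointD[OF coproduct_adjoint_forest_pairing, of E])
  \<comment> \<open>In \<open>\<Delta>([Node F G])\<close> the summand \<open>[Node F G] \<otimes> 1\<close> contributes nothing,
    as \<open>t\<close> pairs to \<open>0\<close> with \<open>1\<close>.\<close>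
  have "forest_pairing H [Node F G] = (lin_form (\<lambda>(a1, a2). lin_form (\<lambda>(b1, b2).
      forest_pairing E (a1 @ b1) * forest_pairing [t] [Node a2 b2]) (Delta_forest G)) (Delta_forest F) :: 'k)"
    by (simp add: snoc forest_pairing_append tensor_pairing_simps forest_pairing_Nil_right)
      (simp add: tensor_pairing_def lin_form_cograft case_prod_unfold)
  also have "\<dots> = tensor_pairing (\<lambda>F G. forest_pairing G F) F G (Delta_forest E * gamma t)"
    by (simp add: tensor_pairing_mult[OF coproduct_adjoint_forest_pairing_transpose
          coproduct_adjoint_forest_pairing_transpose] g d)
  finally show ?thesis
    by (simp add: snoc Gamma_basis)
qed

lemma forest_pairing_sym: "forest_pairing F G = (forest_pairing G F :: 'k::field)"
proof (induction F arbitrary: G rule: forest_induct)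
  case Nil
  show ?case by (simp add: forest_pairing_Nil forest_pairing_Nil_right)
next
  case (Cons F F' H)
  have t: "forest_pairing [Node F F'] E = (forest_pairing E [Node F F'] :: 'k)" for E
    by (simp add: forest_pairing_Node forest_pairing_Node_right tensor_pairing_def Cons.IH(1,2))
  have "forest_pairing (Node F F' # H) G = (tensor_pairing forest_pairing [Node F F'] H (Delta_forest G) :: 'k)"
    using forest_pairing_append[of "[Node F F']" H G] by simp
  also have "\<dots> = lin_form (\<lambda>(a, b). forest_pairing a [Node F F'] * forest_pairing b H) (Delta_forest G)"
    by (simp add: tensor_pairing_def t Cons.IH(3))
  also have "\<dots> = forest_pairing G ([Node F F'] @ H)"
    by (rule coproduct_adjointD[OF coproduct_adjoint_forest_pairing, symmetric])
  finally show ?case by simp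
qed

lemma is_Phi_pairing: "is_Phi pairing"
  using is_Phi_Phi by (simp add: pairing_def[abs_def])

lemma pairing_linear_left: "Vector_Spaces.linear scale (*) (\<lambda>x. pairing x z)"
  and pairing_linear_right: "Vector_Spaces.linear scale (*) (pairing x)"
  using is_Phi_pairing unfolding is_Phi_def graded_dual_def by blast+

lemma pairing_basis: "pairing (basis F) (basis G) = forest_pairing F G"
  by (simp add: pairing_def Phi_basis forest_pairing_def)

lemma pairing_expand: "pairing x y = lin_form (\<lambda>F. lin_form (\<lambda>G. forest_pairing F G) y) x"
proof -
  have "pairing (basis F) y = lin_form (\<lambda>G. forest_pairing F G) y" for F
    by (subst linear_form_expand[OF pairing_linear_right]) (simp add: pairing_basis)
  then show ?thesis
    by (subst linear_form_expand[OF pairing_linear_left]) simp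
qed

lemma pairing_sym: "pairing x y = pairing y x"
proof (rule linear_form_basis_eq[OF pairing_linear_left pairing_linear_right])
  fix F
  show "pairing (basis F) y = pairing y (basis F)"
    by (rule linear_form_basis_eq[OF pairing_linear_right pairing_linear_left])
      (simp add: pairing_basis forest_pairing_sym)
qed

lemma pairing_degree:
  assumes "homogeneous m x" "homogeneous n y" "m \<noteq> n"
  shows "pairing x y = 0"
  unfolding pairing_expand
  using assms by (intro lin_form_eq_0 forest_pairing_degree) (auto simp: homogeneous_def)

lemma pairing_mult: "pairing (x * y) = dual_mult (pairing x) (pairing y)"
  using is_Phi_pairing unfolding is_Phi_def by blast

lemma pairing_graft: "pairing (graft (tensor x y)) = Gamma_star (pairing x) (pairing y)"
  using is_Phi_pairing unfolding is_Phi_def by blast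

section \<open>The antipode\<close>

lemma dual_mult_0: "dual_mult (\<lambda>_. 0) g = (\<lambda>_. 0)" "dual_mult g (\<lambda>_. 0) = (\<lambda>_. 0)"
  by (auto simp: dual_mult_def tensor_form_eq intro!: lin_form_eq_0)

lemma dual_mult_lin_form:
  "dual_mult (\<lambda>z. lin_form (\<lambda>a. f a z) x) g z = lin_form (\<lambda>a. dual_mult (f a) g z) x"
  "dual_mult g (\<lambda>z. lin_form (\<lambda>a. f a z) x) z = lin_form (\<lambda>a. dual_mult g (f a) z) x"
  by (induction x rule: bt_induct; simp add: lin_form_simps dual_mult_simps)+

text \<open>
  Convolution of maps from the coalgebra of forests to the dual algebra; a bilinear form is such a
  map through its first argument.
\<close>

definition conv_dual ::
    "(forest \<Rightarrow> 'k::field bt \<Rightarrow> 'k) \<Rightarrow> (forest \<Rightarrow> 'k bt \<Rightarrow> 'k) \<Rightarrow> forest \<Rightarrow> 'k bt \<Rightarrow> 'k" where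
  "conv_dual f g F z = lin_form (\<lambda>(a, b). dual_mult (f a) (g b) z) (Delta_forest F)"

definition conv_dual_unit :: "forest \<Rightarrow> 'k::field bt \<Rightarrow> 'k" where
  "conv_dual_unit F z = (if F = [] then counit z else 0)"

lemma conv_dual_assoc: "conv_dual (conv_dual f g) h = conv_dual f (conv_dual g h)"
proof (intro ext)
  fix F z
  let ?m = "lin_form (\<lambda>(a, b, c). dual_mult (f a) (dual_mult (g b) (h c)) z)"
  have "conv_dual (conv_dual f g) h F z = ?m (Delta_id (Delta_forest F))"
    by (simp add: conv_dual_def[abs_def] dual_mult_lin_form dual_mult_assoc Delta_id_def inR_def
        lin_form_lin_comp lin_form_simps case_prod_unfold)
  also have "\<dots> = ?m (id_Delta (Delta_forest F))"
    by (simp add: coassoc)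
  also have "\<dots> = conv_dual f (conv_dual g h) F z"
    by (simp add: conv_dual_def[abs_def] dual_mult_lin_form id_Delta_def inL_def
        lin_form_lin_comp lin_form_simps case_prod_unfold)
  finally show "conv_dual (conv_dual f g) h F z = conv_dual f (conv_dual g h) F z" .
qed

lemma conv_dual_unit:
  assumes f: "\<And>F. Vector_Spaces.linear scale (*) (f F)"
  shows "conv_dual f conv_dual_unit = f" "conv_dual conv_dual_unit f = f"
proof -
  have u: "conv_dual_unit F = (if F = [] then counit else (\<lambda>_. 0))" for F
    by (auto simp: conv_dual_unit_def)
  show "conv_dual f conv_dual_unit = f"
  proof (intro ext)
    fix F z
    have "conv_dual f conv_dual_unit F z
        = lin_form (\<lambda>(a, b). if b = [] then f a z else 0) (Delta_forest F)"
      unfolding conv_dual_def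
      by (intro lin_form_cong) (auto simp: u dual_mult_0 dual_mult_counit f)
    also have "\<dots> = lin_form (\<lambda>a. f a z) (lin (\<lambda>(a, b). if b = [] then basis a else 0) (Delta_forest F))"
      unfolding lin_form_lin_comp by (intro lin_form_cong) (auto simp: lin_form_simps)
    finally show "conv_dual f conv_dual_unit F z = f F z"
      by (simp add: counit_right lin_form_simps)
  qed
  show "conv_dual conv_dual_unit f = f"
  proof (intro ext)
    fix F z
    have "conv_dual conv_dual_unit f F z
        = lin_form (\<lambda>(a, b). if a = [] then f b z else 0) (Delta_forest F)"
      unfolding conv_dual_def
      by (intro lin_form_cong) (auto simp: u dual_mult_0 dual_mult_counit f)
    also have "\<dots> = lin_form (\<lambda>b. f b z) (lin (\<lambda>(a, b). if a = [] then basis b else 0) (Delta_forest F))"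
      unfolding lin_form_lin_comp by (intro lin_form_cong) (auto simp: lin_form_simps)
    finally show "conv_dual conv_dual_unit f F z = f F z"
      by (simp add: counit_left lin_form_simps)
  qed
qed

lemma linear_antipode: "Vector_Spaces.linear scale scale antipode"
  and antipode_left: "lin (\<lambda>(F, G). antipode (basis F) * basis G) (Delta x) = scale (counit x) 1"
  and antipode_right: "lin (\<lambda>(F, G). basis F * antipode (basis G)) (Delta x) = scale (counit x) 1"
  using is_antipode_antipode unfolding is_antipode_def by blast+

lemma pairing_one: "pairing 1 = counit"
  using is_Phi_pairing unfolding is_Phi_def by blast

text \<open>
  The adjunction between product and coproduct in the second argument: the multiplicativity of
  \<open>\<Phi>\<close> read through the symmetry of the pairing.
\<close>

lemma pairing_mult_right:
  "pairing (basis F) (x * y) = lin_form (\<lambda>(a, b). pairing (basis a) x * pairing (basis b) y) (Delta_forest F)"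
  by (simp add: pairing_sym[of "basis F"] pairing_mult dual_mult_def tensor_form_eq Delta_basis
      pairing_sym[of "basis _"])

lemma linear_pairing_antipode: "Vector_Spaces.linear scale (*) (\<lambda>y. pairing x (antipode y))"
  using linear_antipode[where 'a = 'a] pairing_linear_right[of x] by (simp add: linear_form_iff linear_scale_iff)

text \<open>
  In \<open>conv_dual\<close>, \<open>L * P = 1\<close> holds because \<open>\<langle>-, y\<rangle>\<close> turns products on the left into
  coproducts on the right and \<open>\<Sum> S(x\<^sup>1)x\<^sup>2 = \<epsilon>(x)1\<close>.  Likewise \<open>P * R = 1\<close> holds by the
  adjunction in the other argument.  So \<open>L\<close> and \<open>R\<close> are a left and a right inverse of
  the same element of an associative algebra.
\<close>

lemma pairing_antipode: "pairing (antipode x) y = pairing x (antipode y)"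
proof -
  define P L R :: "forest \<Rightarrow> 'a bt \<Rightarrow> 'a" where "P = (\<lambda>F. pairing (basis F))"
    and "L = (\<lambda>F. pairing (antipode (basis F)))"
    and "R = (\<lambda>F z. pairing (basis F) (antipode z))"
  have c: "Vector_Spaces.linear scale (*) (conv_dual f g F)" for f g :: "forest \<Rightarrow> 'a bt \<Rightarrow> 'a" and F
    using linear_dual_mult[of "f _" "g _"]
    by (simp add: linear_form_iff conv_dual_def case_prod_unfold lin_form_fun)
  have u: "Vector_Spaces.linear scale (*) (conv_dual_unit F :: 'a bt \<Rightarrow> 'a)" for F
    using linear_counit[where 'a = 'a] by (simp add: linear_form_iff conv_dual_unit_def)
  have LP: "conv_dual L P = conv_dual_unit"
  proof (intro ext)
    fix F and z :: "'a bt"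
    have "conv_dual L P F z = lin_form (\<lambda>a. pairing (case a of (a, b) \<Rightarrow> antipode (basis a) * basis b) z) (Delta_forest F)"
      by (simp add: conv_dual_def L_def P_def case_prod_unfold pairing_mult)
    also have "\<dots> = pairing (lin (\<lambda>(a, b). antipode (basis a) * basis b) (Delta (basis F))) z"
      unfolding linear_form_lin[OF pairing_linear_left] Delta_basis ..
    also have "\<dots> = conv_dual_unit F z"
      using pairing_linear_left[of z]
      by (simp add: antipode_left linear_form_iff counit_basis conv_dual_unit_def pairing_one)
    finally show "conv_dual L P F z = conv_dual_unit F z" .
  qed
  have one: "pairing (basis F) (scale c 1) = c * counit (basis F)" for F and c :: 'a
    using pairing_linear_right[of "basis F :: 'a bt"] pairing_sym[of "basis F" "1 :: 'a bt"]
    by (simp add: linear_form_iff pairing_one)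
  have PR: "conv_dual P R = conv_dual_unit"
  proof
    fix F
    have "conv_dual P R F (basis G) = conv_dual_unit F (basis G)" for G
    proof -
      let ?w = "\<lambda>(a, b) (c, d). pairing (basis a) (basis c) * pairing (basis b) (antipode (basis d))"
      have "conv_dual P R F (basis G) = lin_form (\<lambda>p. lin_form (?w p) (Delta_forest G)) (Delta_forest F)"
        by (simp add: conv_dual_def P_def R_def dual_mult_def tensor_form_eq Delta_basis case_prod_unfold)
      also have "\<dots> = lin_form (\<lambda>q. lin_form (\<lambda>p. ?w p q) (Delta_forest F)) (Delta_forest G)"
        unfolding lin_form_def sum_distrib_left
        by (subst sum.swap) (simp add: mult.left_commute)
      also have "\<dots> = lin_form (\<lambda>q. pairing (basis F) (case q of (c, d) \<Rightarrow> basis c * antipode (basis d))) (Delta_forest G)"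
        by (simp add: pairing_mult_right case_prod_unfold)
      also have "\<dots> = pairing (basis F) (lin (\<lambda>(c, d). basis c * antipode (basis d)) (Delta (basis G)))"
        unfolding linear_form_lin[OF pairing_linear_right] Delta_basis ..
      also have "\<dots> = counit (basis G) * counit (basis F)"
        by (simp add: antipode_right one)
      also have "\<dots> = conv_dual_unit F (basis G)"
        by (simp add: counit_basis conv_dual_unit_def)
      finally show ?thesis .
    qed
    then show "conv_dual P R F = conv_dual_unit F"
      by (intro ext) (rule linear_form_basis_eq[OF c u])
  qed
  have "L = conv_dual L (conv_dual P R)"
    by (simp add: PR conv_dual_unit L_def pairing_linear_right)
  also have "\<dots> = R"
    by (simp add: LP conv_dual_unit R_def linear_pairing_antipode flip: conv_dual_assoc)
  finally have b: "pairing (antipode (basis F)) y = pairing (basis F) (antipode y)" for F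
    by (simp add: L_def R_def fun_eq_iff)
  have l: "Vector_Spaces.linear scale (*) (\<lambda>x. pairing (antipode x) y)"
    using linear_pairing_antipode[of y] by (simp add: pairing_sym[of y])
  show ?thesis
    by (rule linear_form_basis_eq[OF l pairing_linear_left]) (rule b)
qed

theorem theorem27:
  shows "(\<forall>x :: 'k::field bt. pairing 1 x = counit x) \<and>
    (\<forall>x y z :: 'k bt. pairing (x * y) z =
       (\<Sum>(F, G)\<in>Poly_Mapping.keys (Delta z).
          Poly_Mapping.lookup (Delta z) (F, G) * (pairing x (basis F) * pairing y (basis G)))) \<and>
    (\<forall>x y z :: 'k bt. pairing (graft (tensor x y)) z =
       (\<Sum>(F, G)\<in>Poly_Mapping.keys (Gamma z).
          Poly_Mapping.lookup (Gamma z) (F, G) * (pairing x (basis F) * pairing y (basis G)))) \<and>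
    (\<forall>x y :: 'k bt. pairing x y = pairing y x) \<and>
    (\<forall>(x :: 'k bt) y m n. homogeneous m x \<longrightarrow> homogeneous n y \<longrightarrow> m \<noteq> n \<longrightarrow> pairing x y = 0) \<and>
    (\<forall>x y :: 'k bt. pairing (antipode x) y = pairing x (antipode y))"
proof (intro conjI allI impI)
  fix x y z :: "'k bt"
  show "pairing 1 x = counit x" by (simp add: pairing_one)
  show "pairing (x * y) z = (\<Sum>(F, G)\<in>Poly_Mapping.keys (Delta z).
      Poly_Mapping.lookup (Delta z) (F, G) * (pairing x (basis F) * pairing y (basis G)))"
    by (simp add: pairing_mult dual_mult_def tensor_form_def)
  show "pairing (graft (tensor x y)) z = (\<Sum>(F, G)\<in>Poly_Mapping.keys (Gamma z).
      Poly_Mapping.lookup (Gamma z) (F, G) * (pairing x (basis F) * pairing y (basis G)))"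
    using pairing_graft[of x y] by (simp add: Gamma_star_def tensor_form_def)
  show "pairing x y = pairing y x" by (rule pairing_sym)
  show "pairing (antipode x) y = pairing x (antipode y)" by (rule pairing_antipode)
qed (rule pairing_degree)

end
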